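(* Let $s,t\ge2$ be integers. For every real $k\in[1,s+t-2]$, $\dim_f^k(P_s\square P_t)=k\dim_f(P_s\square P_t)=2k$.
   Context: $P_n$ is the path on $n$ vertices. The Cartesian product $G\square H$ has vertex set $V(G)\times V(H)$, with $(u,w)$ adjacent to $(u',w')$ if and only if either $u=u'$ and $ww'\in E(H)$, or $w=w'$ and $uu'\in E(G)$. For a finite simple connected graph $G$ with at least two vertices, $d(x,y)$ is the length of a shortest path between $x$ and $y$. For distinct $x,y\in V(G)$, let $R\{x,y\}=\{z\in V(G): d(x,z)\neq d(y,z)\}$, and let $\kappa(G)=\min\{|R\{x,y\}|: x\neq y,\ x,y\in V(G)\}$. For a function $g$ on $V(G)$ and $U\subseteq V(G)$, write $g(U)=\sum_{s\in U}g(s)$. For a real number $k\in[1,\kappa(G)]$, a function $g:V(G)\to[0,1]$ is a $k$-resolving function of $G$ if $g(R\{x,y\})\ge k$ for any two distinct vertices $x,y\in V(G)$; the fractional $k$-metric dimension is $\dim_f^k(G)=\min\{g(V(G)): g \text{ is a } k\text{-resolving function of } G\}$. The fractional metric dimension is $\dim_f(G)=\dim_f^1(G)$. (It is known that $\kappa(P_s\square P_t)=s+t-2$.) *)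

theory Defs
  imports Complex_Main "Graph_Theory.Pair_Digraph"
begin

text \<open>
  Simple graphs are symmetric, loop-free digraphs whose arcs are pairs of vertices
  (locale \<^locale>\<open>pair_graph\<close>): each undirected edge is represented by its two orientations.
\<close>

definition path_graph :: "nat \<Rightarrow> nat pair_pre_digraph" where
  "path_graph n = \<lparr> pverts = {..<n},
     parcs = {(i, j). i < n \<and> j < n \<and> (j = Suc i \<or> i = Suc j)} \<rparr>"

definition cartesian_product ::
  "'a pair_pre_digraph \<Rightarrow> 'b pair_pre_digraph \<Rightarrow> ('a \<times> 'b) pair_pre_digraph"
  (infixr \<open>\<box>\<close> 80) where
  "G \<box> H = \<lparr> pverts = pverts G \<times> pverts H,
     parcs = {((u, w), (u', w')).
       (u \<in> pverts G \<and> u = u' \<and> (w, w') \<in> parcs H) \<or>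
       (w \<in> pverts H \<and> w = w' \<and> (u, u') \<in> parcs G)} \<rparr>"

text \<open>The value is meaningful only if \<open>y\<close> is reachable from \<open>x\<close>, in particular for all vertices of
  a connected graph.\<close>

definition graph_dist :: "'a pair_pre_digraph \<Rightarrow> 'a \<Rightarrow> 'a \<Rightarrow> nat" where
  "graph_dist G x y = (LEAST n. \<exists>p. pre_digraph.apath (with_proj G) x p y \<and> length p = n)"

definition resolvers :: "'a pair_pre_digraph \<Rightarrow> 'a \<Rightarrow> 'a \<Rightarrow> 'a set" where
  "resolvers G x y = {z \<in> pverts G. graph_dist G x z \<noteq> graph_dist G y z}"

definition kappa :: "'a pair_pre_digraph \<Rightarrow> nat" where
  "kappa G = Min {card (resolvers G x y) | x y. x \<in> pverts G \<and> y \<in> pverts G \<and> x \<noteq> y}"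

text \<open>Only the values of \<open>g\<close> on the vertices matter. The bounds on \<open>k\<close> are the range in which
  \<open>k\<close>-resolving functions are defined.\<close>

definition k_resolving :: "'a pair_pre_digraph \<Rightarrow> real \<Rightarrow> ('a \<Rightarrow> real) \<Rightarrow> bool" where
  "k_resolving G k g \<longleftrightarrow>
     1 \<le> k \<and> k \<le> real (kappa G) \<and>
     (\<forall>v \<in> pverts G. 0 \<le> g v \<and> g v \<le> 1) \<and>
     (\<forall>x \<in> pverts G. \<forall>y \<in> pverts G. x \<noteq> y \<longrightarrow> k \<le> sum g (resolvers G x y))"

text \<open>\<^const>\<open>Least\<close> rather than an infimum: the minimum is part of the notion, so any
  evaluation has to exhibit a minimiser.\<close>

definition frac_k_metric_dim :: "real \<Rightarrow> 'a pair_pre_digraph \<Rightarrow> real" where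
  "frac_k_metric_dim k G = (LEAST r. \<exists>g. k_resolving G k g \<and> r = sum g (pverts G))"

definition frac_metric_dim :: "'a pair_pre_digraph \<Rightarrow> real" where
  "frac_metric_dim G = frac_k_metric_dim 1 G"

lemma pair_graph_path_graph: "pair_graph (path_graph n)"
proof -
  have "finite {(i, j). i < n \<and> j < n \<and> (j = Suc i \<or> i = Suc j)}"
    by (rule finite_subset[of _ "{..<n} \<times> {..<n}"]) auto
  then show ?thesis
    by unfold_locales (auto simp: path_graph_def symmetric_def intro!: symI)
qed

lemma pair_graph_cartesian_product:
  assumes "pair_graph G" and "pair_graph H"
  shows "pair_graph (G \<box> H)"
proof -
  interpret G: pair_graph G by fact
  interpret H: pair_graph H by fact
  have "parcs (G \<box> H) \<subseteq> (pverts G \<times> pverts H) \<times> (pverts G \<times> pverts H)"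
    using G.in_arcsD1 G.in_arcsD2 H.in_arcsD1 H.in_arcsD2
    by (fastforce simp: cartesian_product_def)
  moreover from this have "finite (parcs (G \<box> H))"
    by (rule finite_subset) simp
  ultimately show ?thesis
    using G.arcs_symmetric H.arcs_symmetric G.no_loops' H.no_loops'
    by unfold_locales
      (auto simp: cartesian_product_def symmetric_def dest: G.wellformed' H.wellformed' intro!: symI)
qed

end

theory Submission
  imports Defs
begin

text \<open>
  Distances in the grid are the \<open>\<ell>\<^sub>1\<close> distances. The two neighbours of a corner are resolved exactly
  by the other vertices of the two sides through that corner, and these sets, taken over
  the four corners, cover every boundary vertex twice; adding up four of the inequalities gives
  \<open>4k \<le> 2 g(V)\<close>. Conversely, any two vertices are resolved by at least half of the
  \<open>2(s + t - 2)\<close> boundary vertices, so the constant weight \<open>k / (s + t - 2)\<close> on the boundary is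
  \<open>k\<close>-resolving and has total weight \<open>2k\<close>.
\<close>

section \<open>Distances\<close>

context pair_wf_digraph
begin

text \<open>An arc lowers the potential \<open>D\<close> by at most one, and \<open>D\<close> is 0
  at the end of the walk.\<close>

lemma awalk_length_ge_potential:
  assumes "awalk x p y" and "D y = (0::nat)"
    and "\<And>u v. (u, v) \<in> parcs G \<Longrightarrow> D u \<le> Suc (D v)"
  shows "D x \<le> length p"
  using assms(1)
proof (induction p arbitrary: x)
  case Nil
  then show ?case using assms(2) by (auto simp: awalk_Nil_iff)
next
  case (Cons e p)
  from Cons.prems have "e \<in> parcs G" "fst e = x" "awalk (snd e) p y"
    by (auto simp: awalk_Cons_iff)
  with Cons.IH[of "snd e"] assms(3)[of "fst e" "snd e"] show ?case by auto
qed

text \<open>Greedy descent: each step lowers \<open>D\<close> by exactly one until \<open>y\<close>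
  is reached. The bound on \<open>D\<close> along the path strengthens the induction so that the
  path can be shown to be simple.\<close>

lemma apath_along_potential:
  assumes "x \<in> pverts G" and "y \<in> pverts G" and "D y = (0::nat)"
    and step: "\<And>u. u \<in> pverts G \<Longrightarrow> u \<noteq> y \<Longrightarrow> \<exists>v. (u, v) \<in> parcs G \<and> D u = Suc (D v)"
  shows "\<exists>p. apath x p y \<and> length p = D x \<and> (\<forall>w \<in> set (awalk_verts x p). D w \<le> D x)"
  using assms(1)
proof (induction "D x" arbitrary: x rule: less_induct)
  case less
  show ?case
  proof (cases "x = y")
    case True
    then show ?thesis using assms(2,3) by (intro exI[of _ "[]"]) (auto simp: apath_Nil_iff)
  next
    case False
    with step less.prems obtain v where v: "(x, v) \<in> parcs G" "D x = Suc (D v)" by blast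
    with less.hyps[of v] obtain p where
      p: "apath v p y" "length p = D v" "\<forall>w \<in> set (awalk_verts v p). D w \<le> D v"
      by (auto dest: in_arcsD2)
    \<comment> \<open>All vertices of \<open>p\<close> have potential at most \<open>D v\<close>,
      which is less than \<open>D x\<close>.\<close>
    then have "x \<notin> set (awalk_verts v p)" using v(2) by force
    with v p show ?thesis
      by (intro exI[of _ "(x, v) # p"]) (auto simp: apath_Cons_iff)
  qed
qed

lemma graph_dist_eq_potential:
  assumes "x \<in> pverts G" and "y \<in> pverts G" and "D y = (0::nat)"
    and "\<And>u v. (u, v) \<in> parcs G \<Longrightarrow> D u \<le> Suc (D v)"
    and "\<And>u. u \<in> pverts G \<Longrightarrow> u \<noteq> y \<Longrightarrow> \<exists>v. (u, v) \<in> parcs G \<and> D u = Suc (D v)"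
  shows "graph_dist G x y = D x"
  unfolding graph_dist_def
proof (rule Least_equality)
  show "\<exists>p. apath x p y \<and> length p = D x"
    using apath_along_potential[of x y D] assms by blast
next
  fix n assume "\<exists>p. apath x p y \<and> length p = n"
  then show "D x \<le> n"
    using awalk_length_ge_potential[of x _ y D] assms(3,4) by (auto simp: apath_def)
qed

end

lemma pverts_grid: "pverts (path_graph s \<box> path_graph t) = {..<s} \<times> {..<t}"
  by (simp add: cartesian_product_def path_graph_def)

lemma parcs_grid:
  "((a, b), (c, d)) \<in> parcs (path_graph s \<box> path_graph t) \<longleftrightarrow>
     a < s \<and> c < s \<and> b < t \<and> d < t \<and>
     (a = c \<and> (b = Suc d \<or> d = Suc b) \<or> b = d \<and> (a = Suc c \<or> c = Suc a))"
  by (auto simp: cartesian_product_def path_graph_def)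

text \<open>Differences are taken in \<open>int\<close> to avoid truncated subtraction;
  \<open>nat\<close> returns to the type of \<open>graph_dist\<close>.\<close>

definition l1_dist :: "nat \<times> nat \<Rightarrow> nat \<times> nat \<Rightarrow> nat" where
  "l1_dist x y = nat (\<bar>int (fst x) - int (fst y)\<bar> + \<bar>int (snd x) - int (snd y)\<bar>)"

lemma graph_dist_grid:
  assumes "x \<in> {..<s} \<times> {..<t}" and "y \<in> {..<s} \<times> {..<t}"
  shows "graph_dist (path_graph s \<box> path_graph t) x y = l1_dist x y"
proof -
  interpret G: pair_graph "path_graph s \<box> path_graph t"
    by (intro pair_graph_cartesian_product pair_graph_path_graph)
  show ?thesis
  proof (rule G.graph_dist_eq_potential[where D = "\<lambda>u. l1_dist u y"])
    show "x \<in> pverts (path_graph s \<box> path_graph t)" "y \<in> pverts (path_graph s \<box> path_graph t)"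
      using assms by (simp_all add: pverts_grid)
    show "l1_dist y y = 0" by (simp add: l1_dist_def)
    show "l1_dist u y \<le> Suc (l1_dist v y)" if "(u, v) \<in> parcs (path_graph s \<box> path_graph t)" for u v
      using that by (cases u; cases v) (auto simp: parcs_grid l1_dist_def)
    fix u assume "u \<in> pverts (path_graph s \<box> path_graph t)" "u \<noteq> y"
    moreover obtain a b c d where ab: "u = (a, b)" and cd: "y = (c, d)" by (cases u; cases y) auto
    ultimately have *: "a < s" "b < t" "c < s" "d < t" "a \<noteq> c \<or> b \<noteq> d"
      using assms(2) by (auto simp: pverts_grid)
    \<comment> \<open>The descending neighbour moves the first coordinate towards \<open>c\<close>,
      and once \<open>a = c\<close>, the second towards \<open>d\<close>.\<close>
    consider "a < c" | "c < a" | "a = c" "b < d" | "a = c" "d < b"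
      using *(5) by linarith
    then show "\<exists>v. (u, v) \<in> parcs (path_graph s \<box> path_graph t) \<and> l1_dist u y = Suc (l1_dist v y)"
    proof cases
      case 1
      then show ?thesis using * unfolding ab cd
        by (intro exI[of _ "(Suc a, b)"]) (auto simp: parcs_grid l1_dist_def)
    next
      case 2
      then show ?thesis using * unfolding ab cd
        by (intro exI[of _ "(a - 1, b)"]) (auto simp: parcs_grid l1_dist_def)
    next
      case 3
      then show ?thesis using * unfolding ab cd
        by (intro exI[of _ "(a, Suc b)"]) (auto simp: parcs_grid l1_dist_def)
    next
      case 4
      then show ?thesis using * unfolding ab cd
        by (intro exI[of _ "(a, b - 1)"]) (auto simp: parcs_grid l1_dist_def)
    qed
  qed
qed

lemma resolvers_grid:
  assumes "x \<in> {..<s} \<times> {..<t}" and "y \<in> {..<s} \<times> {..<t}"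
  shows "resolvers (path_graph s \<box> path_graph t) x y =
           {z \<in> {..<s} \<times> {..<t}. l1_dist x z \<noteq> l1_dist y z}"
  using assms by (auto simp: resolvers_def pverts_grid graph_dist_grid)

section \<open>Boundary vertices\<close>

text \<open>The horizontal sides omit the corners, which makes the union disjoint and its
  cardinality a plain sum.\<close>

definition grid_boundary :: "nat \<Rightarrow> nat \<Rightarrow> (nat \<times> nat) set" where
  "grid_boundary s t = {0, s - 1} \<times> {..<t} \<union> {1..<s - 1} \<times> {0, t - 1}"

lemma grid_boundary_subset: "2 \<le> s \<Longrightarrow> 2 \<le> t \<Longrightarrow> grid_boundary s t \<subseteq> {..<s} \<times> {..<t}"
  by (auto simp: grid_boundary_def)

lemma finite_grid_boundary: "finite (grid_boundary s t)"
  by (simp add: grid_boundary_def)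

lemma card_grid_boundary:
  assumes "2 \<le> s" and "2 \<le> t"
  shows "card (grid_boundary s t) = 2 * (s + t - 2)"
proof -
  have "card (grid_boundary s t) = card ({0, s - 1} \<times> {..<t}) + card ({1..<s - 1} \<times> {0, t - 1})"
    unfolding grid_boundary_def by (rule card_Un_disjoint) auto
  then show ?thesis using assms by (simp add: card_cartesian_product)
qed

lemma swap_in_grid_boundary:
  assumes "2 \<le> s" and "2 \<le> t" and "(i, j) \<in> grid_boundary s t"
  shows "(j, i) \<in> grid_boundary t s"
  using assms by (auto simp: grid_boundary_def)

section \<open>Boundary vertices resolving a given pair\<close>

definition boundary_resolvers :: "nat \<Rightarrow> nat \<Rightarrow> nat \<times> nat \<Rightarrow> nat \<times> nat \<Rightarrow> (nat \<times> nat) set" where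
  "boundary_resolvers s t x y = {z \<in> grid_boundary s t. l1_dist x z \<noteq> l1_dist y z}"

lemma finite_boundary_resolvers: "finite (boundary_resolvers s t x y)"
  by (simp add: boundary_resolvers_def finite_grid_boundary)

text \<open>Transposing the grid preserves distances and the boundary; this reduces pairs with equal
  first coordinate to pairs with equal second coordinate.\<close>

lemma card_boundary_resolvers_swap:
  assumes "2 \<le> s" and "2 \<le> t"
  shows "card (boundary_resolvers t s (b, a) (d, c)) \<le> card (boundary_resolvers s t (a, b) (c, d))"
proof (rule card_inj_on_le[where f = prod.swap])
  show "prod.swap ` boundary_resolvers t s (b, a) (d, c) \<subseteq> boundary_resolvers s t (a, b) (c, d)"
    using swap_in_grid_boundary[OF assms(2,1)]
    by (auto simp: boundary_resolvers_def l1_dist_def add.commute)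
qed (auto simp: finite_boundary_resolvers)

text \<open>If \<open>l1_dist x z - l1_dist y z\<close> vanished at both ends of a row (respectively column) of the grid,
  then \<open>a = c\<close> (respectively \<open>b = d\<close>) would follow.\<close>

lemma card_boundary_resolvers_skew:
  assumes st: "2 \<le> s" "2 \<le> t" and "a < s" "c < s" "b < t" "d < t" and "a \<noteq> c" "b \<noteq> d"
  shows "s + t - 2 \<le> card (boundary_resolvers s t (a, b) (c, d))"
proof -
  let ?R = "boundary_resolvers s t (a, b) (c, d)"
  let ?A = "?R \<inter> {0, s - 1} \<times> {..<t}" and ?B = "?R \<inter> {1..<s - 1} \<times> {0, t - 1}"
  have "j \<in> snd ` ?A" if "j < t" for j
  proof -
    have "l1_dist (a, b) (0, j) \<noteq> l1_dist (c, d) (0, j) \<or>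
          l1_dist (a, b) (s - 1, j) \<noteq> l1_dist (c, d) (s - 1, j)"
      using assms by (auto simp: l1_dist_def)
    then have "(0, j) \<in> ?A \<or> (s - 1, j) \<in> ?A"
      using that by (auto simp: boundary_resolvers_def grid_boundary_def)
    then show ?thesis by force
  qed
  \<comment> \<open>Each of the \<open>t\<close> rows has a resolving end, so \<open>snd\<close>
    maps \<open>?A\<close> onto \<open>{..<t}\<close>.\<close>
  then have A: "t \<le> card ?A"
    using surj_card_le[of ?A "{..<t}" snd] by (auto simp: finite_boundary_resolvers)
  have "i \<in> fst ` ?B" if "i \<in> {1..<s - 1}" for i
  proof -
    have "l1_dist (a, b) (i, 0) \<noteq> l1_dist (c, d) (i, 0) \<or>
          l1_dist (a, b) (i, t - 1) \<noteq> l1_dist (c, d) (i, t - 1)"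
      using assms by (auto simp: l1_dist_def)
    then have "(i, 0) \<in> ?B \<or> (i, t - 1) \<in> ?B"
      using that by (auto simp: boundary_resolvers_def grid_boundary_def)
    then show ?thesis by force
  qed
  then have "{1..<s - 1} \<subseteq> fst ` ?B" by blast
  then have "card {1..<s - 1} \<le> card ?B"
    by (rule surj_card_le[rotated]) (simp add: finite_boundary_resolvers)
  \<comment> \<open>Likewise for the interior columns, of which there are
    \<open>s - 2\<close>.\<close>
  then have B: "s - 1 - 1 \<le> card ?B" unfolding card_atLeastLessThan .
  have "card ?A + card ?B = card (?A \<union> ?B)"
    by (rule card_Un_disjoint[symmetric]) (auto simp: finite_boundary_resolvers)
  also have "\<dots> \<le> card ?R"
    by (rule card_mono) (auto simp: finite_boundary_resolvers)
  finally show ?thesis using A B st by linarith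
qed

text \<open>Both vertical sides resolve, and so does the bottom side except possibly at the midpoint.\<close>

lemma card_boundary_resolvers_row:
  assumes "2 \<le> s" "2 \<le> t" and "a < s" "c < s" and "b < t" and "a \<noteq> c"
  shows "s + t - 2 \<le> card (boundary_resolvers s t (a, b) (c, b))"
proof -
  let ?R = "boundary_resolvers s t (a, b) (c, b)"
  \<comment> \<open>A vertex \<open>(i, 0)\<close> fails to resolve only if
    \<open>2 * i = a + c\<close>. For odd \<open>a + c\<close> the set \<open>?B\<close> merely
    loses one further vertex.\<close>
  let ?A = "{0, s - 1} \<times> {..<t}" and ?B = "({1..<s - 1} - {(a + c) div 2}) \<times> {0::nat}"
  have "?A \<subseteq> ?R"
    using assms by (auto simp: boundary_resolvers_def grid_boundary_def l1_dist_def)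
  moreover have "?B \<subseteq> ?R"
    using assms by (auto simp: boundary_resolvers_def grid_boundary_def l1_dist_def)
  ultimately have "card (?A \<union> ?B) \<le> card ?R"
    by (intro card_mono finite_boundary_resolvers) auto
  moreover have "card (?A \<union> ?B) = card ?A + card ?B"
    by (rule card_Un_disjoint) auto
  moreover have "card ?A = 2 * t"
    using assms by (simp add: card_cartesian_product)
  moreover have "s - 2 - 1 \<le> card ?B"
    using diff_card_le_card_Diff[of "{(a + c) div 2}" "{1..<s - 1}"]
    by (simp add: card_cartesian_product)
  ultimately show ?thesis using assms(1,2) by linarith
qed

lemma card_boundary_resolvers:
  assumes st: "2 \<le> s" "2 \<le> t"
    and "x \<in> {..<s} \<times> {..<t}" and "y \<in> {..<s} \<times> {..<t}" and "x \<noteq> y"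
  shows "s + t - 2 \<le> card (boundary_resolvers s t x y)"
proof -
  obtain a b c d where xy: "x = (a, b)" "y = (c, d)" by (cases x; cases y) auto
  then have bds: "a < s" "c < s" "b < t" "d < t" using assms by auto
  consider "a \<noteq> c" "b \<noteq> d" | "a \<noteq> c" "b = d" | "a = c" "b \<noteq> d" using assms(5) xy by auto
  then show ?thesis
  proof cases
    case 1
    then show ?thesis using card_boundary_resolvers_skew[OF st bds] xy by simp
  next
    case 2
    then show ?thesis using card_boundary_resolvers_row[OF st bds(1-3)] xy by simp
  next
    case 3
    then show ?thesis
      using card_boundary_resolvers_row[OF st(2,1) bds(3,4,1)]
        card_boundary_resolvers_swap[OF st, of b a d c] xy by simp
  qed
qed

lemma boundary_resolvers_eq:
  assumes "2 \<le> s" "2 \<le> t" and "x \<in> {..<s} \<times> {..<t}" and "y \<in> {..<s} \<times> {..<t}"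
  shows "boundary_resolvers s t x y = resolvers (path_graph s \<box> path_graph t) x y \<inter> grid_boundary s t"
  using assms grid_boundary_subset[of s t] by (auto simp: boundary_resolvers_def resolvers_grid)

text \<open>Makes every \<open>k \<le> s + t - 2\<close> admissible in \<open>k_resolving\<close>,
  which demands \<open>k \<le> kappa\<close>.\<close>

lemma kappa_grid_ge:
  assumes "2 \<le> s" and "2 \<le> t"
  shows "s + t - 2 \<le> kappa (path_graph s \<box> path_graph t)"
proof -
  let ?G = "path_graph s \<box> path_graph t" and ?V = "{..<s} \<times> {..<t}"
  let ?S = "{card (resolvers ?G x y) | x y. x \<in> ?V \<and> y \<in> ?V \<and> x \<noteq> y}"
  have "?S \<subseteq> (\<lambda>(x, y). card (resolvers ?G x y)) ` (?V \<times> ?V)" by auto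
  then have "finite ?S" by (rule finite_subset) simp
  moreover have "card (resolvers ?G (0, 0) (0, 1)) \<in> ?S" using assms by fastforce
  then have "?S \<noteq> {}" by blast
  moreover have "s + t - 2 \<le> card (resolvers ?G x y)"
    if "x \<in> ?V" "y \<in> ?V" "x \<noteq> y" for x y
  proof -
    have "card (boundary_resolvers s t x y) \<le> card (resolvers ?G x y)"
      using that assms by (intro card_mono) (auto simp: boundary_resolvers_eq resolvers_grid)
    then show ?thesis using card_boundary_resolvers[OF assms that] by linarith
  qed
  ultimately show ?thesis
    unfolding kappa_def pverts_grid by (intro Min.boundedI) auto
qed

section \<open>The fractional dimension of the grid\<close>

lemma k_resolving_boundary:
  assumes st: "2 \<le> s" "2 \<le> t" and k: "1 \<le> k" "k \<le> real s + real t - 2"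
  defines "g \<equiv> \<lambda>z. if z \<in> grid_boundary s t then k / real (s + t - 2) else 0"
  shows "k_resolving (path_graph s \<box> path_graph t) k g"
    and "sum g (pverts (path_graph s \<box> path_graph t)) = 2 * k"
proof -
  let ?G = "path_graph s \<box> path_graph t"
  have n: "real (s + t - 2) = real s + real t - 2" using st by (simp add: of_nat_diff)
  then have npos: "0 < real (s + t - 2)" using st by linarith
  then have cancel: "real (s + t - 2) * (k / real (s + t - 2)) = k" by simp
  \<comment> \<open>Sums of \<open>g\<close> just count boundary vertices, so the cardinality bounds
    above apply.\<close>
  have sum_g: "sum g U = real (card (U \<inter> grid_boundary s t)) * (k / real (s + t - 2))"
    if "finite U" for U
    using that by (simp add: g_def sum.If_cases)
  have "k \<le> sum g (resolvers ?G x y)"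
    if xy: "x \<in> {..<s} \<times> {..<t}" "y \<in> {..<s} \<times> {..<t}" "x \<noteq> y" for x y
  proof -
    have "k = real (s + t - 2) * (k / real (s + t - 2))" by (rule cancel[symmetric])
    also have "\<dots> \<le> real (card (boundary_resolvers s t x y)) * (k / real (s + t - 2))"
      using card_boundary_resolvers[OF st xy] k by (intro mult_right_mono of_nat_mono) auto
    also have "\<dots> = sum g (resolvers ?G x y)"
      using xy by (simp add: sum_g boundary_resolvers_eq[OF st] resolvers_grid)
    finally show ?thesis .
  qed
  moreover have "k \<le> real (kappa ?G)"
    using kappa_grid_ge[OF st] k n by linarith
  moreover have "0 \<le> g v \<and> g v \<le> 1" for v
    using k n npos by (simp add: g_def)
  ultimately show "k_resolving ?G k g"
    using k by (simp add: k_resolving_def pverts_grid del: mem_Sigma_iff)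
  have "sum g (pverts ?G) = real (2 * (s + t - 2)) * (k / real (s + t - 2))"
    using grid_boundary_subset[OF st] card_grid_boundary[OF st]
    by (simp add: pverts_grid sum_g Int_absorb1)
  then show "sum g (pverts ?G) = 2 * k"
    by (simp only: of_nat_mult of_nat_numeral mult.assoc cancel)
qed

section \<open>Lower bound from the four corners\<close>

lemma l1_dist_eq_iff:
  "l1_dist x z = l1_dist y w \<longleftrightarrow>
     \<bar>int (fst x) - int (fst z)\<bar> + \<bar>int (snd x) - int (snd z)\<bar> =
     \<bar>int (fst y) - int (fst w)\<bar> + \<bar>int (snd y) - int (snd w)\<bar>"
  by (simp add: l1_dist_def eq_nat_nat_iff)

text \<open>A step inward from an end of \<open>{..<n}\<close> comes closer to every point except
  that end itself.\<close>

lemma abs_diff_neighbour_of_end: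
  fixes i n :: nat
  assumes "2 \<le> n" and "i < n"
  shows "\<bar>int 1 - int i\<bar> = \<bar>int 0 - int i\<bar> + (if i = 0 then 1 else -1)"
    and "\<bar>int (n - 2) - int i\<bar> = \<bar>int (n - 1) - int i\<bar> + (if i = n - 1 then 1 else -1)"
  using assms by auto

text \<open>Each neighbour's distance to \<open>(i, j)\<close> is that of the corner plus or minus
  one, with plus iff \<open>(i, j)\<close> lies on the side that the neighbour has stepped off. The
  two distances differ iff the signs do.\<close>

lemma l1_dist_corner_neighbours:
  assumes "2 \<le> s" "2 \<le> t" "i < s" "j < t"
  shows "l1_dist (0, 1) (i, j) \<noteq> l1_dist (1, 0) (i, j) \<longleftrightarrow> (i = 0) \<noteq> (j = 0)"
    and "l1_dist (s - 1, 1) (i, j) \<noteq> l1_dist (s - 2, 0) (i, j) \<longleftrightarrow> (i = s - 1) \<noteq> (j = 0)"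
    and "l1_dist (0, t - 2) (i, j) \<noteq> l1_dist (1, t - 1) (i, j) \<longleftrightarrow> (i = 0) \<noteq> (j = t - 1)"
    and "l1_dist (s - 1, t - 2) (i, j) \<noteq> l1_dist (s - 2, t - 1) (i, j) \<longleftrightarrow>
           (i = s - 1) \<noteq> (j = t - 1)"
proof -
  \<comment> \<open>Here \<open>a\<close> and \<open>b\<close> are the coordinate distances from the
    corner; \<open>P\<close> and \<open>Q\<close> say that \<open>(i, j)\<close> lies on its
    vertical and horizontal side.\<close>
  have signs: "a + (b + (if Q then 1 else -1)) \<noteq> a + (if P then 1 else -1) + b \<longleftrightarrow> P \<noteq> Q"
    for a b :: int and P Q by auto
  note steps = abs_diff_neighbour_of_end[OF assms(1,3)] abs_diff_neighbour_of_end[OF assms(2,4)]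
  show "l1_dist (0, 1) (i, j) \<noteq> l1_dist (1, 0) (i, j) \<longleftrightarrow> (i = 0) \<noteq> (j = 0)"
    and "l1_dist (s - 1, 1) (i, j) \<noteq> l1_dist (s - 2, 0) (i, j) \<longleftrightarrow> (i = s - 1) \<noteq> (j = 0)"
    and "l1_dist (0, t - 2) (i, j) \<noteq> l1_dist (1, t - 1) (i, j) \<longleftrightarrow> (i = 0) \<noteq> (j = t - 1)"
    and "l1_dist (s - 1, t - 2) (i, j) \<noteq> l1_dist (s - 2, t - 1) (i, j) \<longleftrightarrow>
           (i = s - 1) \<noteq> (j = t - 1)"
    unfolding l1_dist_eq_iff fst_conv snd_conv steps by (rule signs)+
qed

lemma k_resolving_grid_ge:
  assumes st: "2 \<le> s" "2 \<le> t" and g: "k_resolving (path_graph s \<box> path_graph t) k g"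
  shows "2 * k \<le> sum g (pverts (path_graph s \<box> path_graph t))"
proof -
  let ?G = "path_graph s \<box> path_graph t" and ?V = "{..<s} \<times> {..<t}"
  \<comment> \<open>Extending by 0 makes all four sums range over \<open>?V\<close>, so they can be
    compared with \<open>2 * g z\<close> termwise.\<close>
  let ?w = "\<lambda>x y z. if l1_dist x z \<noteq> l1_dist y z then g z else 0"
  let ?x1 = "(0, 1)" and ?y1 = "(1, 0)"
  let ?x2 = "(s - 1, 1)" and ?y2 = "(s - 2, 0)"
  let ?x3 = "(0, t - 2)" and ?y3 = "(1, t - 1)"
  let ?x4 = "(s - 1, t - 2)" and ?y4 = "(s - 2, t - 1)"
  have g0: "0 \<le> g z" if "z \<in> ?V" for z
    using g that by (auto simp: k_resolving_def pverts_grid)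
  have ge: "k \<le> (\<Sum>z \<in> ?V. ?w x y z)" if "x \<in> ?V" "y \<in> ?V" "x \<noteq> y" for x y
  proof -
    have "k \<le> sum g (resolvers ?G x y)"
      using g that unfolding k_resolving_def pverts_grid by blast
    also have "\<dots> = (\<Sum>z \<in> ?V. ?w x y z)"
      using that by (simp add: resolvers_grid sum.inter_filter)
    finally show ?thesis .
  qed
  have "4 * k \<le> (\<Sum>z \<in> ?V. ?w ?x1 ?y1 z) + (\<Sum>z \<in> ?V. ?w ?x2 ?y2 z)
      + (\<Sum>z \<in> ?V. ?w ?x3 ?y3 z) + (\<Sum>z \<in> ?V. ?w ?x4 ?y4 z)"
  proof -
    have "k \<le> (\<Sum>z \<in> ?V. ?w ?x1 ?y1 z)" by (rule ge) (use st in auto)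
    moreover have "k \<le> (\<Sum>z \<in> ?V. ?w ?x2 ?y2 z)" by (rule ge) (use st in auto)
    moreover have "k \<le> (\<Sum>z \<in> ?V. ?w ?x3 ?y3 z)" by (rule ge) (use st in auto)
    moreover have "k \<le> (\<Sum>z \<in> ?V. ?w ?x4 ?y4 z)" by (rule ge) (use st in auto)
    ultimately show ?thesis by linarith
  qed
  also have "\<dots> = (\<Sum>z \<in> ?V. ?w ?x1 ?y1 z + ?w ?x2 ?y2 z + ?w ?x3 ?y3 z + ?w ?x4 ?y4 z)"
    by (simp only: sum.distrib)
  also have "\<dots> \<le> (\<Sum>z \<in> ?V. 2 * g z)"
  proof (rule sum_mono)
    fix z assume z: "z \<in> ?V"
    obtain i j where ij: "z = (i, j)" by (cases z)
    with z have ijlt: "i < s" "j < t" by auto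
    \<comment> \<open>Opposite sides are disjoint. Hence a vertex inside one side counts for the two
      corners of that side, a corner for its two adjacent corners, and an interior vertex for
      none.\<close>
    have "\<not> (i = 0 \<and> i = s - 1)" "\<not> (j = 0 \<and> j = t - 1)" using st by auto
    with g0[OF z] show "?w ?x1 ?y1 z + ?w ?x2 ?y2 z + ?w ?x3 ?y3 z + ?w ?x4 ?y4 z \<le> 2 * g z"
      unfolding ij l1_dist_corner_neighbours[OF st ijlt]
      by (cases "i = 0"; cases "i = s - 1"; cases "j = 0"; cases "j = t - 1") simp_all
  qed
  finally show ?thesis by (simp add: pverts_grid sum_distrib_left[symmetric])
qed

lemma frac_k_metric_dim_grid:
  assumes "2 \<le> s" "2 \<le> t" and "1 \<le> k" "k \<le> real s + real t - 2"
  shows "frac_k_metric_dim k (path_graph s \<box> path_graph t) = 2 * k"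
  unfolding frac_k_metric_dim_def
proof (rule Least_equality)
  show "\<exists>g. k_resolving (path_graph s \<box> path_graph t) k g
      \<and> 2 * k = sum g (pverts (path_graph s \<box> path_graph t))"
    using k_resolving_boundary[OF assms] by metis
qed (use k_resolving_grid_ge[OF assms(1,2)] in auto)

theorem proposition4p14:
  fixes s t :: nat and k :: real
  assumes "2 \<le> s" and "2 \<le> t"
    and "1 \<le> k" and "k \<le> real s + real t - 2"
  shows "frac_k_metric_dim k (path_graph s \<box> path_graph t)
           = k * frac_metric_dim (path_graph s \<box> path_graph t)
       \<and> k * frac_metric_dim (path_graph s \<box> path_graph t) = 2 * k"
  \<comment> \<open>The instance \<open>k = 1\<close> is admissible since
    \<open>s + t - 2 \<ge> 2\<close>, and gives fractional dimension 2.\<close>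
  using frac_k_metric_dim_grid[OF assms] frac_k_metric_dim_grid[of s t 1] assms
  by (simp add: frac_metric_dim_def)

end
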